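(* Let $(V,E)$ be a finite directed acyclic graph with a set of swept edges $E_S\subset E$, let $K\ge 1$ be an integer, and let $(V_1,E_1),\ldots,(V_K,E_K)$ be a sequence of $K$ subgraphs of $(V,E)$. This sequence is a valid decomposition of $(V,E,E_S)$ (that is, it satisfies Criteria 1, 2 and 3 listed in the context) if and only if there exists a triplet of integers $(c_i,d_i,e_i)$ for each vertex $i\in V$ such that all of the following constraints are satisfied: 1. $c_i\le d_i$ for all $i\in V$; 2. $c_i=1$ for all $i$ in the source of $(V,E)$; 3. $d_i=K$ for all $i$ in the sink of $(V,E)$; 4. $c_i\le c_j\le d_i$ for all $(i,j)\in E$; 5. $c_i\le e_i\le c_i+1$ for all $i\in V$; 6. $e_i\le e_j$ for all $(i,j)\in E$; 7. $e_i+1\le e_j$ for all $(i,j)\in E_S$; 8. $c_i+1\le e_i$ for all $i\in V$ for which there exists an edge $(j,i)\in E_S$; and such that, for all $k=1,\ldots,K$, $V_k=\{i\in V: c_i\le k\le d_i\}$ and $E_k=\{(i,j)\in E: c_j=k\}$.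
   Context: All graphs are finite. $(V,E)$ is a directed acyclic graph and $E_S\subset E$ is a distinguished set of edges, called swept edges. A subgraph $(V_k,E_k)$ of $(V,E)$ consists of $V_k\subset V$ and $E_k\subset E$ such that both endpoints of every edge in $E_k$ lie in $V_k$. The source of a (sub)graph is the set of its vertices having no incoming edge in that (sub)graph; the sink is the set of its vertices having no outgoing edge in that (sub)graph. A sequence of subgraphs $(V_1,E_1),\ldots,(V_K,E_K)$ is a valid decomposition if the following three criteria hold. Criterion 1: Each edge in $E$ belongs to one and only one of the sets $E_1,\ldots,E_K$; moreover, for each vertex $i\in V$, all incoming edges of $i$ belong to one and the same $E_k$. Criterion 2: For each $k$ with $2\le k\le K$, the source of $(V_k,E_k)$ is contained in $V_{k-1}$. The source of $(V_1,E_1)$ equals the source of $(V,E)$. The sink of $(V,E)$ is contained in $V_K$. Criterion 3: For every $k$, no directed path within $(V_k,E_k)$ contains two edges of $E_S$. *)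

theory Defs
  imports "Graph_Theory.Graph_Theory"
begin

definition source :: "('a, 'b) pre_digraph \<Rightarrow> 'a set" where
  "source G = {v \<in> verts G. in_arcs G v = {}}"

definition sink :: "('a, 'b) pre_digraph \<Rightarrow> 'a set" where
  "sink G = {v \<in> verts G. out_arcs G v = {}}"

text \<open>
  A sequence of \<open>K\<close> subgraphs is a function on the naturals, of which only the values at
  \<open>1, \<dots>, K\<close> are ever used.
\<close>

definition criterion1 ::
    "nat \<Rightarrow> 'a pair_pre_digraph \<Rightarrow> (nat \<Rightarrow> 'a pair_pre_digraph) \<Rightarrow> bool" where
  "criterion1 K G H \<longleftrightarrow>
     (\<forall>a \<in> parcs G. \<exists>!k. k \<in> {1..K} \<and> a \<in> parcs (H k)) \<and>
     (\<forall>i \<in> pverts G. \<exists>k \<in> {1..K}. in_arcs (with_proj G) i \<subseteq> parcs (H k))"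

definition criterion2 ::
    "nat \<Rightarrow> 'a pair_pre_digraph \<Rightarrow> (nat \<Rightarrow> 'a pair_pre_digraph) \<Rightarrow> bool" where
  "criterion2 K G H \<longleftrightarrow>
     (\<forall>k \<in> {2..K}. source (with_proj (H k)) \<subseteq> pverts (H (k - 1))) \<and>
     source (with_proj (H 1)) = source (with_proj G) \<and>
     sink (with_proj G) \<subseteq> pverts (H K)"

definition criterion3 ::
    "nat \<Rightarrow> ('a \<times> 'a) set \<Rightarrow> (nat \<Rightarrow> 'a pair_pre_digraph) \<Rightarrow> bool" where
  "criterion3 K ES H \<longleftrightarrow>
     (\<forall>k \<in> {1..K}. \<not> (\<exists>u p v. pre_digraph.apath (with_proj (H k)) u p v \<and>
        (\<exists>a \<in> set p \<inter> ES. \<exists>b \<in> set p \<inter> ES. a \<noteq> b)))"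

definition valid_decomposition ::
    "nat \<Rightarrow> 'a pair_pre_digraph \<Rightarrow> ('a \<times> 'a) set \<Rightarrow> (nat \<Rightarrow> 'a pair_pre_digraph) \<Rightarrow> bool" where
  "valid_decomposition K G ES H \<longleftrightarrow>
     criterion1 K G H \<and> criterion2 K G H \<and> criterion3 K ES H"

end

theory Submission
  imports Defs
begin

text \<open>
  Given a valid decomposition, let \<open>c i\<close> be the index of the subgraph holding all arcs into \<open>i\<close>
  (\<open>1\<close> if there are none) and \<open>d i\<close> the last index whose subgraph contains \<open>i\<close>. A vertex of
  \<open>H k\<close> with \<open>k \<noteq> c i\<close> has no arc into it in \<open>H k\<close>, so Criterion 2 pushes it down to \<open>H (k - 1)\<close>;
  hence the indices of the subgraphs containing \<open>i\<close> form the interval from \<open>c i\<close> to \<open>d i\<close>.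
  Finally \<open>e i\<close> is \<open>c i + 1\<close> if some path of \<open>H (c i)\<close> ending in \<open>i\<close> uses a swept arc, and \<open>c i\<close>
  otherwise. Conversely, on a path in \<open>H k\<close> all heads have \<open>c = k\<close>; \<open>e\<close> reaches \<open>k + 1\<close> after the
  first swept arc and would have to reach \<open>k + 2\<close> after a second one.
\<close>

section \<open>Subgraphs and walks in pair digraphs\<close>

lemma pair_wf_digraph_if_subgraph:
  assumes "subgraph (with_proj H) (with_proj G)"
  shows "pair_wf_digraph H"
proof -
  interpret wf_digraph "with_proj H" using assms by (simp add: subgraph_def)
  show ?thesis
    by unfold_locales (use tail_in_verts head_in_verts in simp_all)
qed

text \<open>A repeated vertex would split off a nonempty closed walk. This lets Criterion 3, stated
  for paths, be applied to walks.\<close>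

lemma (in pair_wf_digraph) apath_if_awalk_acyclic:
  assumes "acyclic (parcs G)" and "awalk u p v"
  shows "apath u p v"
proof (rule ccontr)
  assume "\<not> apath u p v"
  then have "\<not> distinct (awalk_verts u p)"
    using assms(2) by (simp add: apath_def)
  then obtain r w where "awalk w r w" "0 < length r"
    using awalk_not_distinct_decomp[OF assms(2)] by auto
  then have "(w, w) \<in> (parcs G)\<^sup>+"
    by (intro reachable1_awalkI) auto
  with assms(1) show False by (simp add: acyclic_def)
qed

lemma (in pair_wf_digraph) awalk_mono:
  fixes f :: "'a \<Rightarrow> 'b :: preorder"
  assumes "awalk u p v" and "\<And>i j. (i, j) \<in> parcs G \<Longrightarrow> f i \<le> f j"
  shows "f u \<le> f v"
  using assms(1)
proof (induction p arbitrary: u)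
  case (Cons a p)
  have "f (fst a) \<le> f (snd a)"
    using Cons.prems assms(2)[of "fst a" "snd a"] by (simp add: awalk_Cons_iff)
  then show ?case using Cons order_trans by (auto simp: awalk_Cons_iff)
qed (simp add: awalk_Nil_iff)

lemma (in pair_wf_digraph) awalk_append_Cons_iff:
  "awalk u (p @ a # q) v \<longleftrightarrow> awalk u p (fst a) \<and> a \<in> parcs G \<and> awalk (snd a) q v"
  by (induction p arbitrary: u)
    (auto simp: awalk_simps arc_fst_in_verts simp del: awalk_append_iff)

text \<open>Cutting the walk at \<open>a\<close> leaves \<open>b\<close> in one of the two
  remainders, which is then cut at \<open>b\<close>. The two cases are the two possible orders of
  the arcs.\<close>

lemma (in pair_wf_digraph) awalk_two_arcs:
  assumes "awalk u p v" and "a \<in> set p" and "b \<in> set p" and "a \<noteq> b"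
  obtains q where "awalk (snd a) q (fst b)" | q where "awalk (snd b) q (fst a)"
proof -
  obtain p1 p2 where p: "p = p1 @ a # p2"
    using assms(2) by (meson split_list)
  then have walks: "awalk u p1 (fst a)" "awalk (snd a) p2 v"
    using assms(1) by (simp_all only: awalk_append_Cons_iff)
  consider "b \<in> set p1" | "b \<in> set p2" using p assms by auto
  then show thesis
  proof cases
    case 1
    then obtain q1 q2 where "p1 = q1 @ b # q2" by (meson split_list)
    then have "awalk (snd b) q2 (fst a)"
      using walks(1) by (simp only: awalk_append_Cons_iff)
    then show thesis by (rule that(2))
  next
    case 2
    then obtain q1 q2 where "p2 = q1 @ b # q2" by (meson split_list)
    then have "awalk (snd a) q1 (fst b)"
      using walks(2) by (simp only: awalk_append_Cons_iff)
    then show thesis by (rule that(1))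
  qed
qed

section \<open>From potentials to a valid decomposition\<close>

lemma valid_decomposition_if_potentials:
  fixes G :: "'a pair_pre_digraph" and c d e :: "'a \<Rightarrow> int"
  assumes "pair_fin_digraph G" and acyclic: "acyclic (parcs G)" and K: "K \<ge> 1"
    and sub: "\<And>k. k \<in> {1..K} \<Longrightarrow> subgraph (with_proj (H k)) (with_proj G)"
    and cd: "\<And>i. i \<in> pverts G \<Longrightarrow> c i \<le> d i"
    and c_source: "\<And>i. i \<in> source (with_proj G) \<Longrightarrow> c i = 1"
    and d_sink: "\<And>i. i \<in> sink (with_proj G) \<Longrightarrow> d i = int K"
    and c_arc: "\<And>i j. (i, j) \<in> parcs G \<Longrightarrow> c i \<le> c j \<and> c j \<le> d i"
    and ec: "\<And>i. i \<in> pverts G \<Longrightarrow> e i \<le> c i + 1"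
    and e_arc: "\<And>i j. (i, j) \<in> parcs G \<Longrightarrow> e i \<le> e j"
    and e_swept: "\<And>i j. (i, j) \<in> ES \<Longrightarrow> e i + 1 \<le> e j"
    and e_swept_head: "\<And>i j. (j, i) \<in> ES \<Longrightarrow> i \<in> pverts G \<Longrightarrow> c i + 1 \<le> e i"
    and V: "\<And>k. k \<in> {1..K} \<Longrightarrow> pverts (H k) = {i \<in> pverts G. c i \<le> int k \<and> int k \<le> d i}"
    and E: "\<And>k. k \<in> {1..K} \<Longrightarrow> parcs (H k) = {(i, j). (i, j) \<in> parcs G \<and> c j = int k}"
  shows "valid_decomposition K G ES H"
proof -
  interpret pair_fin_digraph G by fact
  \<comment> \<open>The range of \<open>c\<close> is not among the constraints. The lower bound
    spreads forward from the sources, where \<open>c\<close> is 1, since \<open>c\<close> does not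
    decrease along arcs.\<close>
  have c_ge: "c i \<ge> 1" if "i \<in> pverts G" for i
    using finite_acyclic_wf[OF pair_finite_arcs acyclic] that
  proof (induction i rule: wf_induct_rule)
    case (less i)
    show ?case
    proof (cases "i \<in> source (with_proj G)")
      case False
      then obtain j where j: "(j, i) \<in> parcs G"
        using less.prems by (auto simp: source_def)
      with less.IH[OF j] c_arc[OF j] in_arcsD1[OF j] show ?thesis by simp
    qed (simp add: c_source)
  qed
  \<comment> \<open>The upper bound spreads backward from the sinks, where
    \<open>c i \<le> d i = K\<close>.\<close>
  have c_le: "c i \<le> int K" if "i \<in> pverts G" for i
    using finite_acyclic_wf_converse[OF pair_finite_arcs acyclic] that
  proof (induction i rule: wf_induct_rule)
    case (less i)
    show ?case
    proof (cases "i \<in> sink (with_proj G)")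
      case True
      then show ?thesis using cd[OF less.prems] d_sink by simp
    next
      case False
      then obtain j where j: "(i, j) \<in> parcs G"
        using less.prems by (auto simp: sink_def)
      with less.IH[of j] c_arc[OF j] in_arcsD2[OF j] show ?thesis by simp
    qed
  qed
  have nat_c: "nat (c i) \<in> {1..K}" "int (nat (c i)) = c i" if "i \<in> pverts G" for i
    using c_ge[OF that] c_le[OF that] by auto
  have "criterion1 K G H"
    unfolding criterion1_def
  proof (intro conjI ballI)
    fix a assume a: "a \<in> parcs G"
    then have v: "snd a \<in> pverts G" by (rule arc_snd_in_verts)
    show "\<exists>!k. k \<in> {1..K} \<and> a \<in> parcs (H k)"
      by (rule ex1I[of _ "nat (c (snd a))"]) (use a nat_c[OF v] E in \<open>auto split: prod.splits\<close>)
  next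
    fix i assume i: "i \<in> pverts G"
    show "\<exists>k\<in>{1..K}. in_arcs (with_proj G) i \<subseteq> parcs (H k)"
      by (rule bexI[OF _ nat_c(1)[OF i]]) (use nat_c[OF i] E in auto)
  qed
  moreover have "criterion2 K G H"
    unfolding criterion2_def
  proof (intro conjI ballI subsetI)
    fix k i assume k: "k \<in> {2..K}" and i: "i \<in> source (with_proj (H k))"
    from i have iV: "i \<in> pverts G" "c i \<le> int k" "int k \<le> d i"
      using V[of k] k by (auto simp: source_def)
    \<comment> \<open>Since \<open>k \<ge> 2\<close>, equality would make \<open>i\<close> a
      non-source of \<open>G\<close>, and any arc of \<open>G\<close> into \<open>i\<close> would
      then lie in \<open>H k\<close>.\<close>
    have "c i \<noteq> int k"
    proof
      assume eq: "c i = int k"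
      then have "i \<notin> source (with_proj G)" using c_source k by fastforce
      then obtain j where "(j, i) \<in> parcs G" using iV by (auto simp: source_def)
      then have "(j, i) \<in> parcs (H k)" using E[of k] k eq by auto
      with i show False by (auto simp: source_def in_arcs_def)
    qed
    then have "c i \<le> int (k - 1)" "int (k - 1) \<le> d i" using iV k by auto
    moreover have "k - 1 \<in> {1..K}" using k by auto
    ultimately show "i \<in> pverts (H (k - 1))" using V iV(1) by blast
  next
    have one: "1 \<in> {1..K}" using K by simp
    show "source (with_proj (H 1)) = source (with_proj G)"
    proof (intro equalityI subsetI)
      fix i assume i: "i \<in> source (with_proj (H 1))"
      then have iV: "i \<in> pverts G" "c i \<le> 1" using V[OF one] by (auto simp: source_def)
      then have "c i = 1" using c_ge by fastforce
      with i iV show "i \<in> source (with_proj G)"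
        using E[OF one] by (auto simp: source_def in_arcs_def)
    next
      fix i assume i: "i \<in> source (with_proj G)"
      then have "i \<in> pverts G" "c i = 1" using c_source by (auto simp: source_def)
      with i cd[of i] show "i \<in> source (with_proj (H 1))"
        using V[OF one] E[OF one] by (auto simp: source_def in_arcs_def)
    qed
  next
    fix i assume i: "i \<in> sink (with_proj G)"
    then have "i \<in> pverts G" by (simp add: sink_def)
    with d_sink[OF i] c_le[of i] show "i \<in> pverts (H K)" using V[of K] K by simp
  qed
  moreover have "criterion3 K ES H"
    unfolding criterion3_def
  proof (intro ballI notI, elim exE conjE bexE)
    fix k u p v a b
    assume k: "k \<in> {1..K}" and path: "pre_digraph.apath (with_proj (H k)) u p v"
      and a: "a \<in> set p \<inter> ES" and b: "b \<in> set p \<inter> ES" and "a \<noteq> b"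
    interpret Hk: pair_wf_digraph "H k"
      by (rule pair_wf_digraph_if_subgraph[OF sub[OF k]])
    have walk: "Hk.awalk u p v" using path by (rule Hk.awalkI_apath)
    \<comment> \<open>Here \<open>x\<close> is the earlier swept arc and \<open>y\<close> the later
      one; both are kept general because the order of \<open>a\<close> and \<open>b\<close> on the
      path is unknown.\<close>
    have no_walk: False
      if x: "x \<in> set p \<inter> ES" and y: "y \<in> set p \<inter> ES" and xy: "Hk.awalk (snd x) q (fst y)" for x y q
    proof -
      have "x \<in> parcs (H k)" "y \<in> parcs (H k)" using walk x y by auto
      then have "c (snd x) = int k" "c (snd y) = int k" "snd x \<in> pverts G" "snd y \<in> pverts G"
        using E[OF k] by (auto dest: in_arcsD2)
      moreover have "e (snd x) \<le> e (fst y)"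
        by (rule Hk.awalk_mono[OF xy]) (use E[OF k] e_arc in auto)
      moreover have "e (fst y) + 1 \<le> e (snd y)" using y by (simp add: e_swept)
      moreover have "c (snd x) + 1 \<le> e (snd x)"
        using x calculation(3) e_swept_head[of "fst x" "snd x"] by simp
      moreover have "e (snd y) \<le> c (snd y) + 1" using calculation(4) by (rule ec)
      ultimately show False by linarith
    qed
    show False
      using Hk.awalk_two_arcs[OF walk _ _ \<open>a \<noteq> b\<close>] no_walk[OF a b] no_walk[OF b a] a b
      by blast
  qed
  ultimately show ?thesis by (simp add: valid_decomposition_def)
qed

section \<open>From a valid decomposition to potentials\<close>

lemma potentials_if_valid_decomposition:
  fixes G :: "'a pair_pre_digraph"
  assumes "pair_fin_digraph G" and acyclic: "acyclic (parcs G)" and ES: "ES \<subseteq> parcs G" and K: "K \<ge> 1"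
    and sub: "\<And>k. k \<in> {1..K} \<Longrightarrow> subgraph (with_proj (H k)) (with_proj G)"
    and valid: "valid_decomposition K G ES H"
  obtains c d e :: "'a \<Rightarrow> int" where
    "\<forall>i \<in> pverts G. c i \<le> d i"
    "\<forall>i \<in> source (with_proj G). c i = 1"
    "\<forall>i \<in> sink (with_proj G). d i = int K"
    "\<forall>(i, j) \<in> parcs G. c i \<le> c j \<and> c j \<le> d i"
    "\<forall>i \<in> pverts G. c i \<le> e i \<and> e i \<le> c i + 1"
    "\<forall>(i, j) \<in> parcs G. e i \<le> e j"
    "\<forall>(i, j) \<in> ES. e i + 1 \<le> e j"
    "\<forall>i \<in> pverts G. (\<exists>j. (j, i) \<in> ES) \<longrightarrow> c i + 1 \<le> e i"
    "\<forall>k \<in> {1..K}.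
       pverts (H k) = {i \<in> pverts G. c i \<le> int k \<and> int k \<le> d i} \<and>
       parcs (H k) = {(i, j). (i, j) \<in> parcs G \<and> c j = int k}"
proof -
  interpret pair_fin_digraph G by fact
  have crit: "criterion1 K G H" "criterion2 K G H" "criterion3 K ES H"
    using valid by (simp_all add: valid_decomposition_def)
  have sub_verts: "pverts (H k) \<subseteq> pverts G" and sub_arcs: "parcs (H k) \<subseteq> parcs G"
    and wf_H: "pair_wf_digraph (H k)" if "k \<in> {1..K}" for k
    using sub[OF that] pair_wf_digraph_if_subgraph[OF sub[OF that]] by (auto simp: subgraph_def)
  have uniq: "k = l" if "a \<in> parcs (H k)" "a \<in> parcs (H l)" "k \<in> {1..K}" "l \<in> {1..K}" for a k l
    using crit(1) that sub_arcs[of k] unfolding criterion1_def by blast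
  obtain f where f: "\<And>i. i \<in> pverts G \<Longrightarrow> f i \<in> {1..K} \<and> in_arcs (with_proj G) i \<subseteq> parcs (H (f i))"
    using crit(1) unfolding criterion1_def by metis
  \<comment> \<open>At a source no arc comes in, so \<open>f i\<close> may be any index there; the
    value 1 is what the constraint on sources demands.\<close>
  define c where "c i = (if i \<in> source (with_proj G) then 1 else f i)" for i
  define d where "d i = Max {k \<in> {1..K}. i \<in> pverts (H k)}" for i
  \<comment> \<open>Walks are easier to extend than paths; acyclicity turns them into paths once
    Criterion 3 is invoked.\<close>
  define S where "S i \<longleftrightarrow> (\<exists>u p. pre_digraph.awalk (with_proj (H (c i))) u p i \<and> set p \<inter> ES \<noteq> {})" for i
  define e where "e i = (if S i then c i + 1 else c i)" for i
  have c_range: "c i \<in> {1..K}" if "i \<in> pverts G" for i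
    using f[OF that] K by (auto simp: c_def)
  have arc_c: "(i, j) \<in> parcs (H (c j))" if "(i, j) \<in> parcs G" for i j
    using f[of j] that in_arcsD2[OF that] by (auto simp: c_def source_def in_arcs_def)
  have E: "parcs (H k) = {(i, j). (i, j) \<in> parcs G \<and> c j = k}" if k: "k \<in> {1..K}" for k
  proof (intro equalityI subsetI; clarify)
    fix i j assume ij: "(i, j) \<in> parcs (H k)"
    then have G: "(i, j) \<in> parcs G" using sub_arcs[OF k] by auto
    then show "(i, j) \<in> parcs G \<and> c j = k"
      using uniq[OF arc_c[OF G] ij c_range[OF in_arcsD2[OF G]] k] by simp
  next
    fix i j assume "(i, j) \<in> parcs G" "k = c j"
    then show "(i, j) \<in> parcs (H (c j))" by (simp add: arc_c)
  qed
  have arc_verts: "i \<in> pverts (H (c j))" "j \<in> pverts (H (c j))" if "(i, j) \<in> parcs G" for i j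
  proof -
    interpret Hj: pair_wf_digraph "H (c j)"
      using wf_H[OF c_range[OF in_arcsD2[OF that]]] .
    show "i \<in> pverts (H (c j))" "j \<in> pverts (H (c j))"
      using Hj.in_arcsD1[OF arc_c[OF that]] Hj.in_arcsD2[OF arc_c[OF that]] .
  qed
  have one: "1 \<in> {1..K}" using K by simp
  have source1: "source (with_proj (H 1)) = source (with_proj G)"
    using crit(2) by (simp add: criterion2_def)
  have own: "i \<in> pverts (H (c i))" if "i \<in> pverts G" for i
  proof (cases "i \<in> source (with_proj G)")
    case True
    then show ?thesis using source1 by (auto simp: c_def source_def)
  next
    case False
    then obtain j where "(j, i) \<in> parcs G" using \<open>i \<in> pverts G\<close> by (auto simp: source_def)
    then show ?thesis by (rule arc_verts)
  qed
  \<comment> \<open>By \<open>E\<close>, every head of an arc of \<open>H k\<close> has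
    \<open>c\<close> equal to \<open>k\<close>.\<close>
  have source_H: "i \<in> source (with_proj (H k))" if "k \<in> {1..K}" "i \<in> pverts (H k)" "c i \<noteq> k" for i k
    using that E[OF that(1)] by (auto simp: source_def in_arcs_def)
  have down: "i \<in> pverts (H (k - 1))" if "k \<in> {2..K}" "i \<in> pverts (H k)" "c i \<noteq> k" for i k
    using crit(2) source_H[of k i] that unfolding criterion2_def by auto
  have interval: "c i \<le> k \<and> (\<forall>l. c i \<le> l \<and> l \<le> k \<longrightarrow> i \<in> pverts (H l))"
    if "k \<in> {1..K}" "i \<in> pverts (H k)" for i k
    using that
  proof (induction k)
    case (Suc k)
    show ?case
    proof (cases "c i = Suc k")
      case True
      then show ?thesis using Suc.prems by auto
    next
      case False
      \<comment> \<open>The descent cannot pass below index 1: a vertex of \<open>H 1\<close> with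
        \<open>c i \<noteq> 1\<close> would be a source of \<open>H 1\<close>, hence of
        \<open>G\<close>, where \<open>c\<close> is 1.\<close>
      have "k \<noteq> 0"
      proof
        assume "k = 0"
        then have "i \<in> source (with_proj G)" using source_H[OF Suc.prems False] source1 by simp
        then show False using False \<open>k = 0\<close> by (simp add: c_def)
      qed
      then have "i \<in> pverts (H k)" using down[of "Suc k" i] Suc.prems False by simp
      with Suc \<open>k \<noteq> 0\<close> show ?thesis by (auto simp: le_Suc_eq)
    qed
  qed simp
  have d_ge: "k \<le> d i" if "k \<in> {1..K}" "i \<in> pverts (H k)" for i k
    unfolding d_def using that by (intro Max_ge) auto
  have d_mem: "d i \<in> {1..K} \<and> i \<in> pverts (H (d i))" if "i \<in> pverts G" for i
  proof -
    have "d i \<in> {k \<in> {1..K}. i \<in> pverts (H k)}"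
      unfolding d_def using c_range[OF that] own[OF that] by (intro Max_in) auto
    then show ?thesis by simp
  qed
  have V: "pverts (H k) = {i \<in> pverts G. c i \<le> k \<and> k \<le> d i}" if k: "k \<in> {1..K}" for k
  proof (intro equalityI subsetI)
    fix i assume "i \<in> pverts (H k)"
    then show "i \<in> {i \<in> pverts G. c i \<le> k \<and> k \<le> d i}"
      using sub_verts[OF k] interval[OF k] d_ge[OF k] by auto
  next
    fix i assume "i \<in> {i \<in> pverts G. c i \<le> k \<and> k \<le> d i}"
    then show "i \<in> pverts (H k)"
      using d_mem[of i] interval[of "d i" i] by simp
  qed
  \<comment> \<open>The tail \<open>i\<close> also lies in \<open>H (c j)\<close>, so
    \<open>c j\<close> belongs to the interval of \<open>i\<close>.\<close>
  have c_arc: "c i \<le> c j \<and> c j \<le> d i" if "(i, j) \<in> parcs G" for i j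
    using interval[OF c_range[OF in_arcsD2[OF that]] arc_verts(1)[OF that]]
      d_ge[OF c_range[OF in_arcsD2[OF that]] arc_verts(1)[OF that]] by simp
  \<comment> \<open>The last arc is kept apart from \<open>p\<close>, so that a swept arc is known
    to occur before it; \<open>not_S\<close> needs this.\<close>
  have extend: "\<exists>u p. pre_digraph.awalk (with_proj (H (c j))) u (p @ [(i, j)]) j \<and> set p \<inter> ES \<noteq> {}"
    if ij: "(i, j) \<in> parcs G" and "c i = c j" and "S i" for i j
  proof -
    interpret Hj: pair_wf_digraph "H (c j)"
      using wf_H[OF c_range[OF in_arcsD2[OF ij]]] .
    obtain u p where "Hj.awalk u p i" "set p \<inter> ES \<noteq> {}"
      using \<open>S i\<close> \<open>c i = c j\<close> by (auto simp: S_def)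
    moreover have "Hj.awalk i [(i, j)] j"
      using Hj.arc_implies_awalk[OF arc_c[OF ij]] by simp
    ultimately show ?thesis using Hj.awalk_appendI by blast
  qed
  have S_step: "S j" if ij: "(i, j) \<in> parcs G" "c i = c j" "S i" for i j
  proof -
    obtain u p where "pre_digraph.awalk (with_proj (H (c j))) u (p @ [(i, j)]) j" "set p \<inter> ES \<noteq> {}"
      using extend[OF ij] by blast
    then show ?thesis
      unfolding S_def by (intro exI[of _ u] exI[of _ "p @ [(i, j)]"]) auto
  qed
  have S_swept: "S j" if "(i, j) \<in> ES" for i j
  proof -
    have ij: "(i, j) \<in> parcs G" using that ES by auto
    interpret Hj: pair_wf_digraph "H (c j)"
      using wf_H[OF c_range[OF in_arcsD2[OF ij]]] .
    have "Hj.awalk i [(i, j)] j" using Hj.arc_implies_awalk[OF arc_c[OF ij]] by simp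
    with that show ?thesis
      unfolding S_def by (intro exI[of _ i] exI[of _ "[(i, j)]"]) simp
  qed
  have not_S: "\<not> S i" if swept: "(i, j) \<in> ES" and eq: "c i = c j" for i j
  proof
    assume "S i"
    have ij: "(i, j) \<in> parcs G" using swept ES by auto
    have cj: "c j \<in> {1..K}" using c_range[OF in_arcsD2[OF ij]] .
    interpret Hj: pair_wf_digraph "H (c j)" using wf_H[OF cj] .
    obtain u p where walk: "Hj.awalk u (p @ [(i, j)]) j" and p: "set p \<inter> ES \<noteq> {}"
      using extend[OF ij eq \<open>S i\<close>] by blast
    have path: "Hj.apath u (p @ [(i, j)]) j"
      by (rule Hj.apath_if_awalk_acyclic[OF _ walk])
        (use acyclic_subset[OF acyclic sub_arcs[OF cj]] in simp)
    \<comment> \<open>The path ends in \<open>j\<close>, so \<open>p\<close> cannot visit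
      \<open>j\<close> earlier. Hence the swept arc in \<open>p\<close> differs from
      \<open>(i, j)\<close>, and the path has two of them.\<close>
    then have "j \<notin> set (pawalk_verts u p)"
      by (simp add: Hj.apath_append_iff)
    then have "(i, j) \<notin> set p"
      using Hj.awalk_verts_arc2[of u p] walk by auto
    then have "\<exists>a \<in> set (p @ [(i, j)]) \<inter> ES. \<exists>b \<in> set (p @ [(i, j)]) \<inter> ES. a \<noteq> b"
      using p swept by auto
    then show False using crit(3) cj path unfolding criterion3_def by blast
  qed
  show thesis
  proof (rule that[of "int \<circ> c" "int \<circ> d" "int \<circ> e"])
    show "\<forall>i \<in> pverts G. (int \<circ> c) i \<le> (int \<circ> d) i"
      using d_ge own c_range by auto
    show "\<forall>i \<in> source (with_proj G). (int \<circ> c) i = 1" by (simp add: c_def)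
    show "\<forall>i \<in> sink (with_proj G). (int \<circ> d) i = int K"
    proof
      fix i assume i: "i \<in> sink (with_proj G)"
      then have "i \<in> pverts G" "i \<in> pverts (H K)"
        using crit(2) by (auto simp: criterion2_def sink_def)
      with d_mem[of i] d_ge[of K i] K show "(int \<circ> d) i = int K" by simp
    qed
    show "\<forall>(i, j) \<in> parcs G. (int \<circ> c) i \<le> (int \<circ> c) j \<and> (int \<circ> c) j \<le> (int \<circ> d) i"
      using c_arc by auto
    show "\<forall>i \<in> pverts G. (int \<circ> c) i \<le> (int \<circ> e) i \<and> (int \<circ> e) i \<le> (int \<circ> c) i + 1"
      by (simp add: e_def)
    show "\<forall>(i, j) \<in> parcs G. (int \<circ> e) i \<le> (int \<circ> e) j"
    proof clarify
      fix i j assume ij: "(i, j) \<in> parcs G"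
      show "(int \<circ> e) i \<le> (int \<circ> e) j"
        \<comment> \<open>If \<open>c i < c j\<close>, then
          \<open>e i \<le> c i + 1 \<le> c j \<le> e j\<close>; only equality needs
          \<open>S_step\<close>.\<close>
        using c_arc[OF ij] S_step[OF ij] by (cases "c i = c j") (auto simp: e_def)
    qed
    show "\<forall>(i, j) \<in> ES. (int \<circ> e) i + 1 \<le> (int \<circ> e) j"
    proof clarify
      fix i j assume ij: "(i, j) \<in> ES"
      then have "c i \<le> c j" using c_arc ES by blast
      then show "(int \<circ> e) i + 1 \<le> (int \<circ> e) j"
        \<comment> \<open>The head always has \<open>e j = c j + 1\<close>. If
          \<open>c i = c j\<close>, then \<open>not_S\<close> gives \<open>e i = c i\<close>;
          otherwise \<open>e i \<le> c i + 1 \<le> c j\<close>.\<close>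
        using not_S[OF ij] S_swept[OF ij] by (cases "c i = c j") (auto simp: e_def)
    qed
    show "\<forall>i \<in> pverts G. (\<exists>j. (j, i) \<in> ES) \<longrightarrow> (int \<circ> c) i + 1 \<le> (int \<circ> e) i"
      using S_swept by (auto simp: e_def)
    show "\<forall>k \<in> {1..K}.
       pverts (H k) = {i \<in> pverts G. (int \<circ> c) i \<le> int k \<and> int k \<le> (int \<circ> d) i} \<and>
       parcs (H k) = {(i, j). (i, j) \<in> parcs G \<and> (int \<circ> c) j = int k}"
      using V E by simp
  qed
qed

theorem mainTheorem1:
  fixes G :: "'a pair_pre_digraph"
    and ES :: "('a \<times> 'a) set"
    and K :: nat
    and H :: "nat \<Rightarrow> 'a pair_pre_digraph"
  assumes "pair_fin_digraph G"
    and "acyclic (parcs G)"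
    and "ES \<subseteq> parcs G"
    and "K \<ge> 1"
    and "\<And>k. k \<in> {1..K} \<Longrightarrow> subgraph (with_proj (H k)) (with_proj G)"
  shows "valid_decomposition K G ES H \<longleftrightarrow>
    (\<exists>c d e :: 'a \<Rightarrow> int.
       (\<forall>i \<in> pverts G. c i \<le> d i) \<and>
       (\<forall>i \<in> source (with_proj G). c i = 1) \<and>
       (\<forall>i \<in> sink (with_proj G). d i = int K) \<and>
       (\<forall>(i, j) \<in> parcs G. c i \<le> c j \<and> c j \<le> d i) \<and>
       (\<forall>i \<in> pverts G. c i \<le> e i \<and> e i \<le> c i + 1) \<and>
       (\<forall>(i, j) \<in> parcs G. e i \<le> e j) \<and>
       (\<forall>(i, j) \<in> ES. e i + 1 \<le> e j) \<and>
       (\<forall>i \<in> pverts G. (\<exists>j. (j, i) \<in> ES) \<longrightarrow> c i + 1 \<le> e i) \<and>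
       (\<forall>k \<in> {1..K}.
          pverts (H k) = {i \<in> pverts G. c i \<le> int k \<and> int k \<le> d i} \<and>
          parcs (H k) = {(i, j). (i, j) \<in> parcs G \<and> c j = int k}))"
  (is "_ \<longleftrightarrow> ?potentials")
proof
  assume "valid_decomposition K G ES H"
  from potentials_if_valid_decomposition[OF assms this] obtain c d e :: "'a \<Rightarrow> int" where
    "\<forall>i \<in> pverts G. c i \<le> d i"
    "\<forall>i \<in> source (with_proj G). c i = 1"
    "\<forall>i \<in> sink (with_proj G). d i = int K"
    "\<forall>(i, j) \<in> parcs G. c i \<le> c j \<and> c j \<le> d i"
    "\<forall>i \<in> pverts G. c i \<le> e i \<and> e i \<le> c i + 1"
    "\<forall>(i, j) \<in> parcs G. e i \<le> e j"
    "\<forall>(i, j) \<in> ES. e i + 1 \<le> e j"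
    "\<forall>i \<in> pverts G. (\<exists>j. (j, i) \<in> ES) \<longrightarrow> c i + 1 \<le> e i"
    "\<forall>k \<in> {1..K}.
       pverts (H k) = {i \<in> pverts G. c i \<le> int k \<and> int k \<le> d i} \<and>
       parcs (H k) = {(i, j). (i, j) \<in> parcs G \<and> c j = int k}" .
  then show ?potentials
    by (intro exI[of _ c] exI[of _ d] exI[of _ e] conjI)
next
  assume ?potentials
  then obtain c d e :: "'a \<Rightarrow> int" where
    "\<forall>i \<in> pverts G. c i \<le> d i"
    "\<forall>i \<in> source (with_proj G). c i = 1"
    "\<forall>i \<in> sink (with_proj G). d i = int K"
    "\<forall>(i, j) \<in> parcs G. c i \<le> c j \<and> c j \<le> d i"
    "\<forall>i \<in> pverts G. c i \<le> e i \<and> e i \<le> c i + 1"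
    "\<forall>(i, j) \<in> parcs G. e i \<le> e j"
    "\<forall>(i, j) \<in> ES. e i + 1 \<le> e j"
    "\<forall>i \<in> pverts G. (\<exists>j. (j, i) \<in> ES) \<longrightarrow> c i + 1 \<le> e i"
    "\<forall>k \<in> {1..K}.
       pverts (H k) = {i \<in> pverts G. c i \<le> int k \<and> int k \<le> d i} \<and>
       parcs (H k) = {(i, j). (i, j) \<in> parcs G \<and> c j = int k}"
    by (elim exE conjE)
  then show "valid_decomposition K G ES H"
    by (intro valid_decomposition_if_potentials[OF assms(1,2,4,5), where c = c and d = d and e = e]) auto
qed

end
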